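(* Let $(X,d,W)$ be a convex metric space and let $(A,B)$ be a pair of nonempty, bounded, closed and convex subsets of $X$ such that $A_0$ is nonempty and $(A,B)$ is proximally compact. Suppose that $T:A\cup B\to A\cup B$ is a relatively Kannan nonexpansive mapping and that $(A,B)$ has proximal quasi-normal structure. Moreover, let $T$ be a cyclic contraction and let $X$ have property (C). Then $T$ has a best proximity point, that is, there exists $u\in A\cup B$ such that $d(u,Tu)=\mathrm{dist}(A,B)$.
   Context: For nonempty subsets $A,B$ of a metric space $(X,d)$, $\mathrm{dist}(A,B)=\inf\{d(u,v):u\in A,\ v\in B\}$ and $\delta(A,B)=\sup\{d(u,v):u\in A,\ v\in B\}$. A pair $(A,B)$ of subsets is said to satisfy a property (nonempty, closed, bounded, convex) if both $A$ and $B$ do; $(A,B)\subseteq(C,D)$ means $A\subseteq C$ and $B\subseteq D$. Put $A_0=\{u\in A: d(u,v')=\mathrm{dist}(A,B)\text{ for some }v'\in B\}$. A convex structure on $(X,d)$ is a mapping $W:X\times X\times[0,1]\to X$ such that for all $u,v,z\in X$ and $\lambda\in[0,1]$, $d(z,W(u,v;\lambda))\le\lambda d(z,u)+(1-\lambda)d(z,v)$. A metric space with a convex structure $W$ is called a convex metric space $(X,d,W)$. A subset $K\subseteq X$ is convex if $W(u,v;\lambda)\in K$ for all $u,v\in K$, $\lambda\in[0,1]$. The space $(X,d,W)$ has property (C) if every bounded decreasing net of nonempty closed convex subsets of $X$ has nonempty intersection. The pair $(A,B)$ is proximally compact if every net $(u_\alpha,v_\alpha)$ in $A\times B$ with $d(u_\alpha,v_\alpha)\to\mathrm{dist}(A,B)$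 has a convergent subnet in $A\times B$. A mapping $T:A\cup B\to A\cup B$ is cyclic if $T(A)\subseteq B$ and $T(B)\subseteq A$. It is relatively Kannan nonexpansive if it is cyclic and $d(Tu,Tv)\le\frac12[d(u,Tu)+d(v,Tv)]$ for all $(u,v)\in A\times B$. It is a cyclic contraction if it is cyclic and there is some $k\in(0,1)$ with $d(Tu,Tv)\le k\,d(u,v)+(1-k)\,\mathrm{dist}(A,B)$ for all $u\in A$, $v\in B$. A pair $(H_1,H_2)$ is a proximal pair if for each $(u,v)\in H_1\times H_2$ there exists $(u',v')\in H_1\times H_2$ with $d(u,v')=d(u',v)=\mathrm{dist}(H_1,H_2)$. A convex pair $(K_1,K_2)$ has proximal quasi-normal structure if for every bounded, closed and convex (nonempty) proximal pair $(H_1,H_2)\subseteq(K_1,K_2)$ with $\mathrm{dist}(H_1,H_2)=\mathrm{dist}(K_1,K_2)$ and $\delta(H_1,H_2)>\mathrm{dist}(H_1,H_2)$, there exists $(p_1,p_2)\in H_1\times H_2$ such that $d(p_1,v)<\delta(H_1,H_2)$ and $d(u,p_2)<\delta(H_1,H_2)$ for all $(u,v)\in H_1\times H_2$. *)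

theory Defs
  imports "HOL-Analysis.Analysis"
begin

section \<open>Nets\<close>

text \<open>A net is a function on a nonempty directed set, given by a carrier \<open>D\<close> and a
  reflexive, transitive relation \<open>le\<close> on it.  Its limits are the library limits along the
  filter generated by the tails of \<open>D\<close>.\<close>

definition directed_set :: "'i set \<Rightarrow> ('i \<Rightarrow> 'i \<Rightarrow> bool) \<Rightarrow> bool" where
  "directed_set D le \<longleftrightarrow> D \<noteq> {} \<and> reflp_on D le \<and> transp_on D le \<and>
     (\<forall>i\<in>D. \<forall>j\<in>D. \<exists>k\<in>D. le i k \<and> le j k)"

definition net_filter :: "'i set \<Rightarrow> ('i \<Rightarrow> 'i \<Rightarrow> bool) \<Rightarrow> 'i filter" where
  "net_filter D le = (INF i\<in>D. principal {j \<in> D. le i j})"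

text \<open>The net obtained by composing a net on \<open>(D, le)\<close> with \<open>\<phi>\<close> is a subnet of it, in the
  sense of Kelley.\<close>

definition subnet_map ::
  "'j set \<Rightarrow> ('j \<Rightarrow> 'j \<Rightarrow> bool) \<Rightarrow> ('j \<Rightarrow> 'i) \<Rightarrow> 'i set \<Rightarrow> ('i \<Rightarrow> 'i \<Rightarrow> bool) \<Rightarrow> bool" where
  "subnet_map E le' \<phi> D le \<longleftrightarrow> directed_set E le' \<and> \<phi> ` E \<subseteq> D \<and>
     (\<forall>i\<in>D. \<exists>m\<in>E. \<forall>n\<in>E. le' m n \<longrightarrow> le i (\<phi> n))"

section \<open>Convex metric spaces\<close>

definition convex_structure :: "('a::metric_space \<Rightarrow> 'a \<Rightarrow> real \<Rightarrow> 'a) \<Rightarrow> bool" where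
  "convex_structure W \<longleftrightarrow>
     (\<forall>u v z. \<forall>l\<in>{0..1}. dist z (W u v l) \<le> l * dist z u + (1 - l) * dist z v)"

definition W_convex :: "('a \<Rightarrow> 'a \<Rightarrow> real \<Rightarrow> 'a) \<Rightarrow> 'a set \<Rightarrow> bool" where
  "W_convex W K \<longleftrightarrow> (\<forall>u\<in>K. \<forall>v\<in>K. \<forall>l\<in>{0..1}. W u v l \<in> K)"

text \<open>A definition cannot quantify over all types of net indices, so the index type is first
  made a parameter and then fixed as \<open>'a set\<close>, which is large enough to give the property for
  every index type: see \<open>property_C_imp_property_C_for\<close>.\<close>

definition property_C_for ::
  "'i itself \<Rightarrow> ('a::metric_space \<Rightarrow> 'a \<Rightarrow> real \<Rightarrow> 'a) \<Rightarrow> bool" where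
  "property_C_for _ W \<longleftrightarrow>
     (\<forall>(D :: 'i set) le (K :: 'i \<Rightarrow> 'a set).
        directed_set D le \<longrightarrow>
        (\<forall>i\<in>D. K i \<noteq> {} \<and> bounded (K i) \<and> closed (K i) \<and> W_convex W (K i)) \<longrightarrow>
        (\<forall>i\<in>D. \<forall>j\<in>D. le i j \<longrightarrow> K j \<subseteq> K i) \<longrightarrow>
        (\<Inter>i\<in>D. K i) \<noteq> {})"

definition property_C :: "('a::metric_space \<Rightarrow> 'a \<Rightarrow> real \<Rightarrow> 'a) \<Rightarrow> bool" where
  "property_C W \<longleftrightarrow> property_C_for TYPE('a set) W"

section \<open>Pairs of sets\<close>

text \<open>\<open>dist(A,B)\<close> is the library's \<open>setdist A B\<close>.  The supremum below is that of the paper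
  whenever \<open>A\<close> and \<open>B\<close> are nonempty and bounded.\<close>

definition delta :: "'a::metric_space set \<Rightarrow> 'a set \<Rightarrow> real" where
  "delta A B = (SUP (u, v) \<in> A \<times> B. dist u v)"

definition proximal_part :: "'a::metric_space set \<Rightarrow> 'a set \<Rightarrow> 'a set" where
  "proximal_part A B = {u \<in> A. \<exists>v\<in>B. dist u v = setdist A B}"

definition proximal_pair :: "'a::metric_space set \<Rightarrow> 'a set \<Rightarrow> bool" where
  "proximal_pair H1 H2 \<longleftrightarrow>
     (\<forall>u\<in>H1. \<forall>v\<in>H2. \<exists>u'\<in>H1. \<exists>v'\<in>H2.
        dist u v' = setdist H1 H2 \<and> dist u' v = setdist H1 H2)"

definition proximal_quasi_normal_structure ::
  "('a::metric_space \<Rightarrow> 'a \<Rightarrow> real \<Rightarrow> 'a) \<Rightarrow> 'a set \<Rightarrow> 'a set \<Rightarrow> bool" where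
  "proximal_quasi_normal_structure W K1 K2 \<longleftrightarrow>
     (\<forall>H1 H2. H1 \<noteq> {} \<and> H2 \<noteq> {} \<and> bounded H1 \<and> bounded H2 \<and> closed H1 \<and> closed H2 \<and>
        W_convex W H1 \<and> W_convex W H2 \<and> proximal_pair H1 H2 \<and> H1 \<subseteq> K1 \<and> H2 \<subseteq> K2 \<and>
        setdist H1 H2 = setdist K1 K2 \<and> delta H1 H2 > setdist H1 H2 \<longrightarrow>
        (\<exists>p1\<in>H1. \<exists>p2\<in>H2. \<forall>u\<in>H1. \<forall>v\<in>H2.
           dist p1 v < delta H1 H2 \<and> dist u p2 < delta H1 H2))"

text \<open>In \<open>proximally_compact_for\<close> the nets have index type \<open>'i\<close> and the subnets have index
  type \<open>'j\<close>.  In \<open>proximally_compact\<close> both are fixed as \<open>('a \<times> 'a \<times> nat) set\<close>; this type is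
  large enough for the choice not to matter, as stated by \<open>proximally_compact_imp_for\<close>
  (nets with any index type) and \<open>proximally_compact_if_for\<close> (subnets with any index type).\<close>

definition proximally_compact_for ::
  "'i itself \<Rightarrow> 'j itself \<Rightarrow> 'a::metric_space set \<Rightarrow> 'a set \<Rightarrow> bool" where
  "proximally_compact_for _ _ A B \<longleftrightarrow>
     (\<forall>(D :: 'i set) le u v.
        directed_set D le \<longrightarrow>
        (\<forall>i\<in>D. u i \<in> A \<and> v i \<in> B) \<longrightarrow>
        ((\<lambda>i. dist (u i) (v i)) \<longlongrightarrow> setdist A B) (net_filter D le) \<longrightarrow>
        (\<exists>(E :: 'j set) le' \<phi>. subnet_map E le' \<phi> D le \<and>
           (\<exists>a\<in>A. \<exists>b\<in>B. ((\<lambda>n. (u (\<phi> n), v (\<phi> n))) \<longlongrightarrow> (a, b)) (net_filter E le'))))"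

definition proximally_compact :: "'a::metric_space set \<Rightarrow> 'a set \<Rightarrow> bool" where
  "proximally_compact A B \<longleftrightarrow>
     proximally_compact_for TYPE(('a \<times> 'a \<times> nat) set) TYPE(('a \<times> 'a \<times> nat) set) A B"

section \<open>Cyclic mappings\<close>

text \<open>A self-map of \<open>A \<union> B\<close> is a function on the whole type of which only the values on
  \<open>A \<union> B\<close> matter.\<close>

definition cyclic :: "'a set \<Rightarrow> 'a set \<Rightarrow> ('a \<Rightarrow> 'a) \<Rightarrow> bool" where
  "cyclic A B T \<longleftrightarrow> T ` A \<subseteq> B \<and> T ` B \<subseteq> A"

definition relatively_Kannan_nonexpansive ::
  "'a::metric_space set \<Rightarrow> 'a set \<Rightarrow> ('a \<Rightarrow> 'a) \<Rightarrow> bool" where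
  "relatively_Kannan_nonexpansive A B T \<longleftrightarrow> cyclic A B T \<and>
     (\<forall>u\<in>A. \<forall>v\<in>B. dist (T u) (T v) \<le> 1 / 2 * (dist u (T u) + dist v (T v)))"

definition cyclic_contraction ::
  "'a::metric_space set \<Rightarrow> 'a set \<Rightarrow> ('a \<Rightarrow> 'a) \<Rightarrow> bool" where
  "cyclic_contraction A B T \<longleftrightarrow> cyclic A B T \<and>
     (\<exists>k\<in>{0<..<1}. \<forall>u\<in>A. \<forall>v\<in>B.
        dist (T u) (T v) \<le> k * dist u v + (1 - k) * setdist A B)"

section \<open>Independence of the index types\<close>

lemma directed_setD:
  assumes "directed_set D le"
  shows "D \<noteq> {}" "\<And>i. i \<in> D \<Longrightarrow> le i i"
    "\<And>i j k. i \<in> D \<Longrightarrow> j \<in> D \<Longrightarrow> k \<in> D \<Longrightarrow> le i j \<Longrightarrow> le j k \<Longrightarrow> le i k"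
    "\<And>i j. i \<in> D \<Longrightarrow> j \<in> D \<Longrightarrow> \<exists>k\<in>D. le i k \<and> le j k"
proof -
  note d = assms[unfolded directed_set_def]
  show "D \<noteq> {}" "\<And>i j. i \<in> D \<Longrightarrow> j \<in> D \<Longrightarrow> \<exists>k\<in>D. le i k \<and> le j k"
    using d by simp_all
  show "le i i" if "i \<in> D" for i
    using d that by (simp add: reflp_on_def)
  show "le i k" if "i \<in> D" "j \<in> D" "k \<in> D" "le i j" "le j k" for i j k
    using d that transp_onD[of D le i j k] by simp
qed

lemma directed_setI:
  assumes "D \<noteq> {}" "\<And>i. i \<in> D \<Longrightarrow> le i i"
    "\<And>i j k. i \<in> D \<Longrightarrow> j \<in> D \<Longrightarrow> k \<in> D \<Longrightarrow> le i j \<Longrightarrow> le j k \<Longrightarrow> le i k"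
    "\<And>i j. i \<in> D \<Longrightarrow> j \<in> D \<Longrightarrow> \<exists>k\<in>D. le i k \<and> le j k"
  shows "directed_set D le"
  unfolding directed_set_def
  by (intro conjI reflp_onI transp_onI ballI) (fact assms)+

lemma eventually_net_filter:
  assumes "directed_set D le"
  shows "eventually P (net_filter D le) \<longleftrightarrow> (\<exists>i\<in>D. \<forall>j\<in>D. le i j \<longrightarrow> P j)"
proof -
  have "eventually P (net_filter D le) \<longleftrightarrow>
      (\<exists>i\<in>D. eventually P (principal {j \<in> D. le i j}))"
    unfolding net_filter_def
  proof (rule eventually_INF_base)
    show "D \<noteq> {}"
      using directed_setD(1)[OF assms] .
  next
    fix i j assume ij: "i \<in> D" "j \<in> D"
    then obtain k where "k \<in> D" "le i k" "le j k"
      using directed_setD(4)[OF assms] by blast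
    then have "{h \<in> D. le k h} \<subseteq> {h \<in> D. le i h} \<inter> {h \<in> D. le j h}"
      using directed_setD(3)[OF assms ij(1)] directed_setD(3)[OF assms ij(2)] by blast
    then show "\<exists>k\<in>D. principal {h \<in> D. le k h} \<le>
        inf (principal {h \<in> D. le i h}) (principal {h \<in> D. le j h})"
      using \<open>k \<in> D\<close> by auto
  qed
  then show ?thesis
    by (auto simp: eventually_principal)
qed

lemma tendsto_net_filter_iff:
  assumes "directed_set D le"
  shows "(x \<longlongrightarrow> l) (net_filter D le) \<longleftrightarrow>
    (\<forall>e>0. \<exists>i\<in>D. \<forall>j\<in>D. le i j \<longrightarrow> dist (x j) l < e)"
  unfolding tendsto_iff eventually_net_filter[OF assms] by blast

lemma property_C_imp_property_C_for:
  assumes "property_C W"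
  shows "property_C_for TYPE('i) W"
  unfolding property_C_for_def
proof (intro allI impI)
  fix D :: "'i set" and le and K :: "'i \<Rightarrow> 'a set"
  assume D: "directed_set D le"
    and K: "\<forall>i\<in>D. K i \<noteq> {} \<and> bounded (K i) \<and> closed (K i) \<and> W_convex W (K i)"
    and mono: "\<forall>i\<in>D. \<forall>j\<in>D. le i j \<longrightarrow> K j \<subseteq> K i"
  have "directed_set (K ` D) (\<lambda>S S'. S' \<subseteq> S)"
  proof (rule directed_setI)
    fix S S' assume "S \<in> K ` D" "S' \<in> K ` D"
    then obtain i j where "i \<in> D" "j \<in> D" "S = K i" "S' = K j" by blast
    moreover from this obtain k where "k \<in> D" "le i k" "le j k"
      using directed_setD(4)[OF D] by blast
    ultimately show "\<exists>k\<in>K ` D. k \<subseteq> S \<and> k \<subseteq> S'"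
      using mono by blast
  qed (use directed_setD(1)[OF D] in auto)
  then have "(\<Inter>S\<in>K ` D. S) \<noteq> {}"
    by (rule assms[unfolded property_C_def property_C_for_def, rule_format])
      (use K in auto)
  then show "(\<Inter>i\<in>D. K i) \<noteq> {}"
    by auto
qed

lemma cluster_point_of_subnet:
  assumes D: "directed_set D le" and sub: "subnet_map E le' \<phi> D le"
    and lim: "((\<lambda>n. x (\<phi> n)) \<longlongrightarrow> l) (net_filter E le')" and "e > 0" "i \<in> D"
  shows "\<exists>j\<in>D. (\<exists>n\<in>E. j = \<phi> n) \<and> le i j \<and> dist (x j) l < e"
proof -
  have E: "directed_set E le'" "\<phi> ` E \<subseteq> D"
    using sub by (auto simp: subnet_map_def)
  obtain m where m: "m \<in> E" "\<forall>n\<in>E. le' m n \<longrightarrow> le i (\<phi> n)"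
    using sub \<open>i \<in> D\<close> unfolding subnet_map_def by blast
  obtain m' where m': "m' \<in> E" "\<forall>n\<in>E. le' m' n \<longrightarrow> dist (x (\<phi> n)) l < e"
    using lim \<open>e > 0\<close> unfolding tendsto_net_filter_iff[OF E(1)] by blast
  obtain n where "n \<in> E" "le' m n" "le' m' n"
    using directed_setD(4)[OF E(1) m(1) m'(1)] by blast
  then show ?thesis
    using m m' E(2) by blast
qed

lemma subnet_of_cluster_point:
  fixes D :: "'i set" and x :: "'i \<Rightarrow> 'b::metric_space" and f :: "'i \<times> nat \<Rightarrow> 'j"
  assumes D: "directed_set D le" and f: "inj f"
    and cl: "\<And>e i. e > 0 \<Longrightarrow> i \<in> D \<Longrightarrow> \<exists>j\<in>D. le i j \<and> dist (x j) l < e"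
  shows "\<exists>(E :: 'j set) le' \<phi>. subnet_map E le' \<phi> D le \<and>
    ((\<lambda>n. x (\<phi> n)) \<longlongrightarrow> l) (net_filter E le')"
proof -
  define g where "g = inv f"
  have g: "g (f p) = p" for p
    using f by (simp add: g_def)
  define E0 where "E0 = {(i, n :: nat). i \<in> D \<and> dist (x i) l < 1 / real (Suc n)}"
  define E where "E = f ` E0"
  define le' where "le' s t \<longleftrightarrow> le (fst (g s)) (fst (g t)) \<and> snd (g s) \<le> snd (g t)" for s t
  define \<phi> where "\<phi> = fst \<circ> g"
  have ex: "\<exists>j. (j, n) \<in> E0 \<and> le i j" if "i \<in> D" for i n
    using cl[of "1 / real (Suc n)" i] that by (auto simp: E0_def)
  have dir: "directed_set E le'"
  proof (rule directed_setI)
    show "E \<noteq> {}"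
      using ex directed_setD(1)[OF D] unfolding E_def by blast
  next
    fix s assume "s \<in> E"
    then show "le' s s"
      using directed_setD(2)[OF D] by (auto simp: E_def E0_def le'_def g)
  next
    fix s t r assume "s \<in> E" "t \<in> E" "r \<in> E" "le' s t" "le' t r"
    then have "fst (g s) \<in> D" "fst (g t) \<in> D" "fst (g r) \<in> D"
        "le (fst (g s)) (fst (g t))" "le (fst (g t)) (fst (g r))" "snd (g s) \<le> snd (g r)"
      by (auto simp: E_def E0_def le'_def g)
    then show "le' s r"
      unfolding le'_def using directed_setD(3)[OF D] by blast
  next
    fix s t assume "s \<in> E" "t \<in> E"
    then obtain i n j m where s: "s = f (i, n)" "(i, n) \<in> E0" and t: "t = f (j, m)" "(j, m) \<in> E0"
      by (auto simp: E_def)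
    have ij: "i \<in> D" "j \<in> D"
      using s t by (auto simp: E0_def)
    obtain k where k: "k \<in> D" "le i k" "le j k"
      using directed_setD(4)[OF D ij] by blast
    obtain h where h: "(h, max n m) \<in> E0" "le k h"
      using ex k(1) by blast
    have "h \<in> D"
      using h by (simp add: E0_def)
    then have "le i h" "le j h"
      using directed_setD(3)[OF D] ij k h by blast+
    then show "\<exists>r\<in>E. le' s r \<and> le' t r"
      using h by (intro bexI[of _ "f (h, max n m)"]) (auto simp: le'_def g s t E_def)
  qed
  have "subnet_map E le' \<phi> D le"
    unfolding subnet_map_def
  proof (intro conjI ballI)
    show "\<phi> ` E \<subseteq> D"
      by (auto simp: E_def E0_def \<phi>_def g)
  next
    fix i assume i: "i \<in> D"
    obtain j where j: "(j, 0) \<in> E0" "le i j"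
      using ex i by blast
    have "le i (\<phi> n)" if "n \<in> E" "le' (f (j, 0)) n" for n
    proof (rule directed_setD(3)[OF D i])
      show "j \<in> D" "\<phi> n \<in> D" "le i j" "le j (\<phi> n)"
        using that j by (auto simp: E_def E0_def le'_def g \<phi>_def)
    qed
    then show "\<exists>m\<in>E. \<forall>n\<in>E. le' m n \<longrightarrow> le i (\<phi> n)"
      using j(1) unfolding E_def by blast
  qed (rule dir)
  moreover have "((\<lambda>n. x (\<phi> n)) \<longlongrightarrow> l) (net_filter E le')"
    unfolding tendsto_net_filter_iff[OF dir]
  proof (intro allI impI)
    fix e :: real assume "e > 0"
    then obtain n where n: "1 / real (Suc n) < e"
      using nat_approx_posE by blast
    obtain i where "i \<in> D"
      using directed_setD(1)[OF D] by blast
    then obtain j where j: "(j, n) \<in> E0"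
      using ex by blast
    have "dist (x k) l < e" if "(k, m) \<in> E0" "n \<le> m" for k m
    proof -
      have "dist (x k) l < 1 / real (Suc m)"
        using that by (simp add: E0_def)
      also have "\<dots> \<le> 1 / real (Suc n)"
        using that(2) by (intro divide_left_mono) auto
      finally show ?thesis
        using n by simp
    qed
    then show "\<exists>i\<in>E. \<forall>j\<in>E. le' i j \<longrightarrow> dist (x (\<phi> j)) l < e"
      using j by (intro bexI[of _ "f (j, n)"]) (auto simp: E_def le'_def g \<phi>_def)
  qed
  ultimately show ?thesis
    by blast
qed

lemma proximally_compact_imp_for:
  fixes A B :: "'a::metric_space set"
  assumes "proximally_compact A B"
  shows "proximally_compact_for TYPE('i) TYPE('i \<times> nat) A B"
  unfolding proximally_compact_for_def
proof (intro allI impI)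
  fix D :: "'i set" and le and u v :: "'i \<Rightarrow> 'a"
  assume D: "directed_set D le" and uv: "\<forall>i\<in>D. u i \<in> A \<and> v i \<in> B"
    and lim: "((\<lambda>i. dist (u i) (v i)) \<longlongrightarrow> setdist A B) (net_filter D le)"
  define tl where "tl i = {(u j, v j) |j. j \<in> D \<and> le i j}" for i
  define enc where "enc i p = {(x, y, 0 :: nat) |x y. (x, y) \<in> tl i} \<union> {(fst p, snd p, 1)}"
    for i and p :: "'a \<times> 'a"
  define base where "base S = {(x, y). (x, y, 0 :: nat) \<in> S}" for S :: "('a \<times> 'a \<times> nat) set"
  define pt where "pt S = (THE p. (fst p, snd p, 1 :: nat) \<in> S)"
    for S :: "('a \<times> 'a \<times> nat) set"
  have base[simp]: "base (enc i p) = tl i" for i p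
    by (auto simp: base_def enc_def)
  have pt[simp]: "pt (enc i p) = p" for i p
    unfolding pt_def by (rule the_equality) (auto simp: enc_def prod_eq_iff)
  define D' where "D' = {enc i p |i p. i \<in> D \<and> p \<in> tl i}"
  define le' where "le' S S' \<longleftrightarrow> base S' \<subseteq> base S" for S S'
  have tl_self: "(u i, v i) \<in> tl i" if "i \<in> D" for i
    using directed_setD(2)[OF D] that by (auto simp: tl_def)
  have tl_mono: "tl j \<subseteq> tl i" if "i \<in> D" "j \<in> D" "le i j" for i j
    using directed_setD(3)[OF D that(1,2) _ that(3)] unfolding tl_def by blast
  have D': "directed_set D' le'"
  proof (rule directed_setI)
    show "D' \<noteq> {}"
      using directed_setD(1)[OF D] tl_self unfolding D'_def by blast
  next
    fix S S' assume "S \<in> D'" "S' \<in> D'"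
    then obtain i p j q where S: "S = enc i p" "i \<in> D" "S' = enc j q" "j \<in> D"
      by (auto simp: D'_def)
    then obtain k where "k \<in> D" "le i k" "le j k"
      using directed_setD(4)[OF D] by blast
    then have "enc k (u k, v k) \<in> D'" "tl k \<subseteq> tl i" "tl k \<subseteq> tl j"
      using S tl_self tl_mono unfolding D'_def by blast+
    then show "\<exists>R\<in>D'. le' S R \<and> le' S' R"
      using S by (intro bexI[of _ "enc k (u k, v k)"]) (simp_all add: le'_def)
  qed (auto simp: le'_def)
  have tail: "\<exists>j\<in>D. le i j \<and> pt S = (u j, v j)" if "i \<in> D" "S \<in> D'" "le' (enc i p) S" for i p S
  proof -
    obtain k q where "S = enc k q" "q \<in> tl k"
      using \<open>S \<in> D'\<close> unfolding D'_def by blast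
    then have "pt S \<in> tl i"
      using \<open>le' (enc i p) S\<close> by (auto simp: le'_def)
    then show ?thesis
      unfolding tl_def by blast
  qed
  have mem: "\<forall>S\<in>D'. fst (pt S) \<in> A \<and> snd (pt S) \<in> B"
    using uv by (auto simp: D'_def tl_def)
  have lim': "((\<lambda>S. dist (fst (pt S)) (snd (pt S))) \<longlongrightarrow> setdist A B) (net_filter D' le')"
    unfolding tendsto_net_filter_iff[OF D']
  proof (intro allI impI)
    fix e :: real assume "e > 0"
    then obtain i where i: "i \<in> D"
      "\<forall>j\<in>D. le i j \<longrightarrow> dist (dist (u j) (v j)) (setdist A B) < e"
      using lim unfolding tendsto_net_filter_iff[OF D] by blast
    have "enc i (u i, v i) \<in> D'"
      using i(1) tl_self unfolding D'_def by blast
    moreover have "dist (dist (fst (pt S)) (snd (pt S))) (setdist A B) < e"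
      if "S \<in> D'" "le' (enc i (u i, v i)) S" for S
      using tail[OF i(1) that] i(2) by auto
    ultimately show "\<exists>i\<in>D'. \<forall>j\<in>D'. le' i j \<longrightarrow>
        dist (dist (fst (pt j)) (snd (pt j))) (setdist A B) < e"
      by blast
  qed
  obtain E :: "('a \<times> 'a \<times> nat) set set" and le'' \<phi> a b
    where sub: "subnet_map E le'' \<phi> D' le'" and ab: "a \<in> A" "b \<in> B"
      and conv: "((\<lambda>n. (fst (pt (\<phi> n)), snd (pt (\<phi> n)))) \<longlongrightarrow> (a, b)) (net_filter E le'')"
    using assms[unfolded proximally_compact_def proximally_compact_for_def, rule_format,
        OF D' _ lim'] mem by blast
  have "\<exists>j\<in>D. le i j \<and> dist (u j, v j) (a, b) < e" if "e > 0" "i \<in> D" for e i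
  proof -
    have "enc i (u i, v i) \<in> D'"
      using that tl_self unfolding D'_def by blast
    then obtain S where "S \<in> D'" "le' (enc i (u i, v i)) S" "dist (pt S) (a, b) < e"
      using cluster_point_of_subnet[OF D' sub, of pt "(a, b)" e] conv \<open>e > 0\<close>
      unfolding prod.collapse by blast
    then show ?thesis
      using tail[OF that(2)] by metis
  qed
  then show "\<exists>(E :: ('i \<times> nat) set) le' \<phi>. subnet_map E le' \<phi> D le \<and>
      (\<exists>a\<in>A. \<exists>b\<in>B. ((\<lambda>n. (u (\<phi> n), v (\<phi> n))) \<longlongrightarrow> (a, b)) (net_filter E le'))"
    using subnet_of_cluster_point[OF D inj_on_id, of "\<lambda>i. (u i, v i)" "(a, b)"] ab
    by blast
qed

lemma proximally_compact_if_for: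
  fixes A B :: "'a::metric_space set"
  assumes "proximally_compact_for TYPE(('a \<times> 'a \<times> nat) set) TYPE('j) A B"
  shows "proximally_compact A B"
  unfolding proximally_compact_def proximally_compact_for_def
proof (intro allI impI)
  fix D :: "('a \<times> 'a \<times> nat) set set" and le u v
  assume D: "directed_set D le" and uv: "\<forall>i\<in>D. u i \<in> A \<and> v i \<in> B"
    and lim: "((\<lambda>i. dist (u i) (v i)) \<longlongrightarrow> setdist A B) (net_filter D le)"
  define f :: "('a \<times> 'a \<times> nat) set \<times> nat \<Rightarrow> ('a \<times> 'a \<times> nat) set" where
    "f = (\<lambda>(S, n). {(x, y, 2 * k) |x y k. (x, y, k) \<in> S} \<union> {(x, y, 2 * n + 1) |x y. True})"
  have "inj f"
  proof (rule injI)
    fix p q assume eq: "f p = f q"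
    obtain S n T m where pq: "p = (S, n)" "q = (T, m)"
      by fastforce
    have ne: "2 * k \<noteq> Suc (2 * l)" for k l :: nat
      by presburger
    have ev: "(x, y, 2 * k) \<in> f (R, l) \<longleftrightarrow> (x, y, k) \<in> R" for x y k R l
      by (auto simp: f_def ne)
    have od: "(x, y, 2 * k + 1) \<in> f (R, l) \<longleftrightarrow> k = l" for x y k R l
      by (auto simp: f_def ne ne[symmetric])
    have "S = T"
    proof (rule set_eqI)
      fix t :: "'a \<times> 'a \<times> nat"
      obtain x y k where "t = (x, y, k)"
        by (rule prod_cases3)
      then show "t \<in> S \<longleftrightarrow> t \<in> T"
        using ev[of x y k S n] ev[of x y k T m] eq pq by simp
    qed
    moreover have "n = m"
      using od[of undefined undefined n S n] od[of undefined undefined n T m] eq pq by simp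
    ultimately show "p = q"
      using pq by simp
  qed
  obtain E :: "'j set" and le' \<phi> a b
    where sub: "subnet_map E le' \<phi> D le" and ab: "a \<in> A" "b \<in> B"
      and conv: "((\<lambda>n. (u (\<phi> n), v (\<phi> n))) \<longlongrightarrow> (a, b)) (net_filter E le')"
    using assms[unfolded proximally_compact_for_def, rule_format, OF D _ lim] uv by blast
  have "\<exists>j\<in>D. le i j \<and> dist (u j, v j) (a, b) < e" if "e > 0" "i \<in> D" for e i
    using cluster_point_of_subnet[OF D sub, of "\<lambda>i. (u i, v i)"] conv that by blast
  then show "\<exists>(E :: ('a \<times> 'a \<times> nat) set set) le' \<phi>. subnet_map E le' \<phi> D le \<and>
      (\<exists>a\<in>A. \<exists>b\<in>B. ((\<lambda>n. (u (\<phi> n), v (\<phi> n))) \<longlongrightarrow> (a, b)) (net_filter E le'))"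
    using subnet_of_cluster_point[OF D \<open>inj f\<close>, of "\<lambda>i. (u i, v i)" "(a, b)"] ab
    by blast
qed

end

theory Submission
  imports Defs
begin

text \<open>For a cyclic contraction, \<open>dist x\<^sub>n x\<^sub>n\<^sub>+\<^sub>1\<close> decreases to \<open>dist(A,B)\<close> along every orbit.
  Starting the orbit in \<open>B\<close>, proximal compactness gives a cluster point \<open>a \<in> A\<close> of
  \<open>x\<^sub>1, x\<^sub>3, x\<^sub>5, \<dots>\<close>. If \<open>u = T y\<close> is such a term close to \<open>a\<close>, then \<open>dist a y\<close> is close to
  \<open>dist(A,B)\<close>, and contractivity applied to \<open>a\<close> and \<open>y\<close> bounds \<open>dist (T a) u\<close>, hence
  \<open>dist a (T a)\<close>, by nearly \<open>dist(A,B)\<close>.\<close>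

lemma directed_set_nat: "directed_set (UNIV :: nat set) (\<le>)"
proof (rule directed_setI)
  show "\<exists>k\<in>UNIV. i \<le> k \<and> j \<le> k" for i j :: nat
    by (rule bexI[of _ "max i j"]) simp_all
qed simp_all

lemma net_filter_nat: "net_filter (UNIV :: nat set) (\<le>) = sequentially"
  by (rule filter_eqI)
    (simp add: eventually_net_filter[OF directed_set_nat] eventually_sequentially)

text \<open>A sequence is a net over \<open>nat\<close>, and the limit of a convergent subnet is a
  cluster point of the net. The cluster form keeps subnets and their index types out of the later
  estimates.\<close>

lemma proximally_compact_cluster_point:
  assumes "proximally_compact A B" and "\<And>n. u n \<in> A" and "\<And>n. v n \<in> B"
    and "(\<lambda>n. dist (u n) (v n)) \<longlonglongrightarrow> setdist A B"
  obtains a b where "a \<in> A" "b \<in> B" "\<forall>e>0. \<forall>N. \<exists>n\<ge>N. dist (u n, v n) (a, b) < e"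
proof -
  have lim: "((\<lambda>n. dist (u n) (v n)) \<longlongrightarrow> setdist A B) (net_filter UNIV (\<le>))"
    using assms(4) by (simp add: net_filter_nat)
  obtain E :: "(nat \<times> nat) set" and le' \<phi> a b
    where sub: "subnet_map E le' \<phi> UNIV (\<le>)" and ab: "a \<in> A" "b \<in> B"
      and conv: "((\<lambda>n. (u (\<phi> n), v (\<phi> n))) \<longlongrightarrow> (a, b)) (net_filter E le')"
    using proximally_compact_imp_for[OF assms(1), unfolded proximally_compact_for_def,
        rule_format, OF directed_set_nat _ lim] assms(2,3) by blast
  have "\<exists>n\<ge>N. dist (u n, v n) (a, b) < e" if "e > 0" for e N
    using cluster_point_of_subnet[OF directed_set_nat sub, of "\<lambda>n. (u n, v n)", OF conv that]
    by blast
  with ab that show thesis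
    by simp
qed

text \<open>Contractivity applied to a point and its image shrinks the excess of
  \<open>dist z (T z)\<close> over \<open>setdist A B\<close> by the factor \<open>k\<close>, so
  along an orbit it decays geometrically.\<close>

lemma cyclic_contraction_orbit:
  assumes "cyclic_contraction A B T" and "x \<in> A \<union> B"
  shows "(\<lambda>n. dist ((T ^^ n) x) ((T ^^ Suc n) x)) \<longlonglongrightarrow> setdist A B"
proof -
  obtain k where k: "0 < k" "k < 1"
    and contr: "\<And>u v. u \<in> A \<Longrightarrow> v \<in> B \<Longrightarrow>
      dist (T u) (T v) \<le> k * dist u v + (1 - k) * setdist A B"
    and cyc: "T ` A \<subseteq> B" "T ` B \<subseteq> A"
    using assms(1) by (auto simp: cyclic_contraction_def cyclic_def)
  define gap where "gap z = dist z (T z) - setdist A B" for z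
  have orbit: "(T ^^ n) x \<in> A \<union> B" for n
    by (induction n) (use assms(2) cyc in auto)
  have gap_nonneg: "0 \<le> gap z" if "z \<in> A \<union> B" for z
    using that cyc setdist_le_dist[of z A "T z" B] setdist_le_dist[of "T z" A z B]
    by (auto simp: gap_def dist_commute)
  have gap_step: "gap (T z) \<le> k * gap z" if "z \<in> A \<union> B" for z
  proof -
    have "dist (T z) (T (T z)) \<le> k * dist z (T z) + (1 - k) * setdist A B"
      using that cyc contr[of z "T z"] contr[of "T z" z] by (auto simp: dist_commute)
    then show ?thesis
      by (simp add: gap_def algebra_simps)
  qed
  have "gap ((T ^^ n) x) \<le> k ^ n * gap x" for n
  proof (induction n)
    case (Suc n)
    have "gap ((T ^^ Suc n) x) \<le> k * gap ((T ^^ n) x)"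
      using gap_step[OF orbit] by simp
    also have "\<dots> \<le> k * (k ^ n * gap x)"
      using Suc k by (intro mult_left_mono) auto
    finally show ?case
      by (simp add: mult.assoc)
  qed simp
  moreover have "(\<lambda>n. k ^ n * gap x) \<longlonglongrightarrow> 0"
    using k by (intro tendsto_mult_left_zero LIMSEQ_realpow_zero) auto
  ultimately have "(\<lambda>n. gap ((T ^^ n) x)) \<longlonglongrightarrow> 0"
    \<comment> \<open>The lower bound is the constant 0; \<open>rotated\<close> moves its inequality
      to the end, where \<open>gap_nonneg\<close> closes it.\<close>
    by (rule tendsto_sandwich[OF always_eventually[OF allI] always_eventually[OF allI]
          tendsto_const, rotated])
      (rule gap_nonneg[OF orbit])
  from tendsto_add[OF this tendsto_const[of "setdist A B"]] show ?thesis
    by (simp add: gap_def)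
qed

lemma cyclic_contraction_best_proximity_point:
  assumes "B \<noteq> {}" and "proximally_compact A B" and T: "cyclic_contraction A B T"
  shows "\<exists>a\<in>A. dist a (T a) = setdist A B"
proof -
  obtain k where k: "0 < k" "k < 1"
    and contr: "\<And>u v. u \<in> A \<Longrightarrow> v \<in> B \<Longrightarrow>
      dist (T u) (T v) \<le> k * dist u v + (1 - k) * setdist A B"
    and cyc: "T ` A \<subseteq> B" "T ` B \<subseteq> A"
    using T by (auto simp: cyclic_contraction_def cyclic_def)
  obtain x where x: "x \<in> B"
    using \<open>B \<noteq> {}\<close> by blast
  \<comment> \<open>Even iterates stay in \<open>B\<close>, so \<open>(T (y n), y n)\<close> lies in
    \<open>A \<times> B\<close>, as proximal compactness requires.\<close>
  define y where "y n = (T ^^ (2 * n)) x" for n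
  have y: "y n \<in> B" for n
    unfolding y_def by (induction n) (use x cyc in auto)
  then have Ty: "T (y n) \<in> A" for n
    using cyc by blast
  have lim: "(\<lambda>n. dist (T (y n)) (y n)) \<longlonglongrightarrow> setdist A B"
    using LIMSEQ_subseq_LIMSEQ[OF cyclic_contraction_orbit[OF T UnI2[OF x]], of "\<lambda>n. 2 * n"]
    by (simp add: strict_mono_def comp_def y_def dist_commute)
  obtain a b where a: "a \<in> A" and "b \<in> B"
    and cluster: "\<forall>e>0. \<forall>N. \<exists>n\<ge>N. dist (T (y n), y n) (a, b) < e"
    by (rule proximally_compact_cluster_point[OF assms(2) Ty y lim])
  have "dist a (T a) \<le> setdist A B"
  proof (rule field_le_epsilon)
    fix e :: real assume "e > 0"
    then obtain N where N: "\<And>n. n \<ge> N \<Longrightarrow> dist (T (y n)) (y n) < setdist A B + e / 3"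
      using order_tendstoD(2)[OF lim, of "setdist A B + e / 3"]
      by (auto simp: eventually_sequentially)
    \<comment> \<open>A cluster point is approached at arbitrarily late indices, so \<open>n\<close>
      can meet both this bound and \<open>N\<close>.\<close>
    obtain n where "n \<ge> N" and near: "dist (T (y n), y n) (a, b) < e / 3"
      using cluster[rule_format, of "e / 3" N] \<open>e > 0\<close> by auto
    have close: "dist a (T (y n)) < e / 3"
      using dist_fst_le[of "(T (y n), y n)" "(a, b)"] near by (simp add: dist_commute)
    have "dist a (y n) \<le> setdist A B + 2 * e / 3"
      using dist_triangle[of a "y n" "T (y n)"] close N[OF \<open>n \<ge> N\<close>] by linarith
    then have "k * dist a (y n) \<le> k * (setdist A B + 2 * e / 3)"
      using k by (intro mult_left_mono) auto
    \<comment> \<open>Only the error term loses its factor \<open>k\<close>: the remaining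
      \<open>k * setdist A B\<close> and the term \<open>(1 - k) * setdist A B\<close> of
      \<open>contr\<close> add up to \<open>setdist A B\<close>.\<close>
    also have "\<dots> \<le> k * setdist A B + 2 * e / 3"
      using mult_right_mono[of k 1 "2 * e / 3"] k \<open>e > 0\<close> by (simp add: distrib_left)
    finally have "dist (T a) (T (y n)) \<le> setdist A B + 2 * e / 3"
      using contr[OF a y, of n] by (simp add: algebra_simps)
    then show "dist a (T a) \<le> setdist A B + e"
      using dist_triangle2[of a "T a" "T (y n)"] close by linarith
  qed
  moreover have "setdist A B \<le> dist a (T a)"
    using a cyc by (intro setdist_le_dist) auto
  ultimately show ?thesis
    using a by force
qed

theorem theorem3p3:
  fixes W :: "'a::metric_space \<Rightarrow> 'a \<Rightarrow> real \<Rightarrow> 'a"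
    and A B :: "'a set" and T :: "'a \<Rightarrow> 'a"
  assumes "convex_structure W"
    and "A \<noteq> {}" and "B \<noteq> {}"
    and "bounded A" and "bounded B"
    and "closed A" and "closed B"
    and "W_convex W A" and "W_convex W B"
    and "proximal_part A B \<noteq> {}"
    and "proximally_compact A B"
    and "relatively_Kannan_nonexpansive A B T"
    and "proximal_quasi_normal_structure W A B"
    and "cyclic_contraction A B T"
    and "property_C W"
  shows "\<exists>u\<in>A \<union> B. dist u (T u) = setdist A B"
  using cyclic_contraction_best_proximity_point[OF assms(3,11,14)] by blast

end
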